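(* Let $n\ge2$. Assume $\Omega\in L^1(S^{n-1})$ is positively homogeneous of degree zero, $k\in L^\infty(\mathbb R^n\times\mathbb R^n)$, and either $f\in L^\infty(\mathbb R^n)$ with compact support or $f\in L^p(\mathbb R^n)$, $1\le p<\infty$. For $\epsilon>0$ define $$T^{(k)}_\epsilon f(x)=\int_{|x-y|>\epsilon}\frac{\Omega(x-y)}{|x-y|^n}\,k(x,y)\,f(y)\,dy$$ and, for $t>0$, $$A_{\epsilon,t}f(x)=\frac1{t^n}\int_{tS\setminus B(0,\epsilon)}f(x-y)\,k(x,x-y)\,\operatorname{sgn}\Omega(y)\,dy,\qquad(1)$$ where $S=S_\Omega$ is the star-shaped set associated with $\Omega$. Then for almost all $x\in\mathbb R^n$ $$T^{(k)}_\epsilon f(x)=n\int_0^\infty A_{\epsilon,t}f(x)\,\frac{dt}{t}\qquad(2)$$ holds, and the integrals in (1) and (2) converge absolutely.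
   Context: $S^{n-1}$ is the unit sphere of $\mathbb R^n$ with surface measure. A function $\Omega$ that is positively homogeneous of degree $0$ ($\Omega(tx)=\Omega(x)$ for $t>0$, $x\neq0$) is identified with its restriction to $S^{n-1}$. For $z\in\mathbb C$, $\operatorname{sgn}z=z/|z|$ if $z\neq0$ and $\operatorname{sgn}0=0$. The star-shaped set associated with $\Omega$ is $S_\Omega=\{x\in\mathbb R^n:|x|\le|\Omega(x)|^{1/n}\}$; $tS=\{tx:x\in S\}$. *)

theory Defs
  imports "HOL-Analysis.Analysis"
begin

(* Surface measure on the unit sphere, by the usual cone formula
     sigma(E) = n * |{x. 0 < |x| <= 1 and x/|x| in E}|   (n the dimension),
   completed so that "measurable" on the sphere means the analogue of Lebesgue measurable. *)
definition sphere_measure :: "'a::euclidean_space measure" where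
  "sphere_measure =
     completion (scale_measure (of_nat DIM('a))
       (distr (restrict_space lborel (cball 0 1 - {0})) (restrict_space borel (sphere 0 1))
         (\<lambda>x. x /\<^sub>R norm x)))"

lemma emeasure_sphere_measure:
  fixes E :: "'a::euclidean_space set"
  assumes "E \<in> sets borel" "E \<subseteq> sphere 0 1"
  shows "emeasure sphere_measure E =
    of_nat DIM('a) * emeasure lborel {x \<in> cball 0 1 - {0}. x /\<^sub>R norm x \<in> E}"
proof -
  let ?B = "cball 0 1 - {0} :: 'a set"
  have m: "(\<lambda>x. x /\<^sub>R norm x) \<in> measurable (restrict_space lborel ?B) (restrict_space borel (sphere 0 1))"
    by (intro measurable_restrict_space3) auto
  have E: "E \<in> sets (restrict_space borel (sphere 0 1))"
    using assms by (subst sets_restrict_space_iff) auto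
  have eq: "(\<lambda>x. x /\<^sub>R norm x) -` E \<inter> ?B = {x \<in> ?B. x /\<^sub>R norm x \<in> E}"
    by blast
  show ?thesis
    unfolding sphere_measure_def eq[symmetric]
    using E m by (simp add: emeasure_distr emeasure_restrict_space space_restrict_space)
qed

(* Membership in L^p (finite p) and L^infinity, for functions rather than equivalence classes. *)
definition Lp :: "real \<Rightarrow> 'a measure \<Rightarrow> ('a \<Rightarrow> complex) set" where
  "Lp p M = {f \<in> borel_measurable M. integrable M (\<lambda>x. norm (f x) powr p)}"

definition Linfty :: "'a measure \<Rightarrow> ('a \<Rightarrow> complex) set" where
  "Linfty M = {f \<in> borel_measurable M. \<exists>C. AE x in M. norm (f x) \<le> C}"

(* Compact essential support, hence invariant under changing f on a null set. *)
definition compactly_supported :: "('a::euclidean_space \<Rightarrow> complex) \<Rightarrow> bool" where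
  "compactly_supported f \<longleftrightarrow> (\<exists>K. compact K \<and> (AE x in lebesgue. x \<notin> K \<longrightarrow> f x = 0))"

definition homogeneous_deg0 :: "('a::real_vector \<Rightarrow> complex) \<Rightarrow> bool" where
  "homogeneous_deg0 \<Omega> \<longleftrightarrow> (\<forall>t x. t > 0 \<longrightarrow> x \<noteq> 0 \<longrightarrow> \<Omega> (t *\<^sub>R x) = \<Omega> x)"

definition star_set :: "('a::euclidean_space \<Rightarrow> complex) \<Rightarrow> 'a set" where
  "star_set \<Omega> = {x. norm x \<le> root DIM('a) (norm (\<Omega> x))}"

definition T_integrand ::
  "('a::euclidean_space \<Rightarrow> complex) \<Rightarrow> ('a \<times> 'a \<Rightarrow> complex) \<Rightarrow> ('a \<Rightarrow> complex) \<Rightarrow> 'a \<Rightarrow> 'a \<Rightarrow> complex" where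
  "T_integrand \<Omega> k f x y = \<Omega> (x - y) / of_real (norm (x - y) ^ DIM('a)) * k (x, y) * f y"

definition T_op ::
  "('a::euclidean_space \<Rightarrow> complex) \<Rightarrow> ('a \<times> 'a \<Rightarrow> complex) \<Rightarrow> real \<Rightarrow> ('a \<Rightarrow> complex) \<Rightarrow> 'a \<Rightarrow> complex" where
  "T_op \<Omega> k \<epsilon> f x = (LINT y:{y. norm (x - y) > \<epsilon>}|lebesgue. T_integrand \<Omega> k f x y)"

(* Here sgn is the library's complex sgn: sgn z = z/|z| for nonzero z, and sgn 0 = 0. *)
definition A_integrand ::
  "('a::euclidean_space \<Rightarrow> complex) \<Rightarrow> ('a \<times> 'a \<Rightarrow> complex) \<Rightarrow> ('a \<Rightarrow> complex) \<Rightarrow> 'a \<Rightarrow> 'a \<Rightarrow> complex" where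
  "A_integrand \<Omega> k f x y = f (x - y) * k (x, x - y) * sgn (\<Omega> y)"

definition A_domain :: "('a::euclidean_space \<Rightarrow> complex) \<Rightarrow> real \<Rightarrow> real \<Rightarrow> 'a set" where
  "A_domain \<Omega> \<epsilon> t = (\<lambda>x. t *\<^sub>R x) ` star_set \<Omega> - ball 0 \<epsilon>"

definition A_op ::
  "('a::euclidean_space \<Rightarrow> complex) \<Rightarrow> ('a \<times> 'a \<Rightarrow> complex) \<Rightarrow> real \<Rightarrow> real \<Rightarrow> ('a \<Rightarrow> complex) \<Rightarrow> 'a \<Rightarrow> complex" where
  "A_op \<Omega> k \<epsilon> t f x =
     of_real (1 / t ^ DIM('a)) * (LINT y:A_domain \<Omega> \<epsilon> t|lebesgue. A_integrand \<Omega> k f x y)"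

end

theory Submission
  imports Defs
begin

text \<open>Fix \<open>x\<close>. Since \<open>y \<in> tS\<close> means \<open>t \<ge> |y| / |\<Omega>(y)|\<^sup>1\<^sup>/\<^sup>n\<close>, Fubini in \<open>(y, t)\<close> turns the right-hand side of
  (2) into an integral of \<open>f(x - y) k(x, x - y) sgn \<Omega>(y)\<close> against
  \<open>n \<integral> t\<^sup>-\<^sup>n\<^sup>-\<^sup>1 dt = |\<Omega>(y)| / |y|\<^sup>n\<close>, which is the left-hand side. The same bound dominates the
  integral in (1), so everything reduces to the finiteness, for almost every \<open>x\<close>, of
  \<open>\<integral> |\<Omega>(y)| |y|\<^sup>-\<^sup>n |f(x - y)| dy\<close> over \<open>|y| \<ge> \<epsilon>\<close>. By Young's inequality
  \<open>|f| / |y| \<le> |f|\<^sup>p + |y|\<^sup>-\<^sup>q\<close> with \<open>1/p + 1/q = 1\<close>. Against the kernel \<open>|\<Omega>(y)| |y|\<^sup>1\<^sup>-\<^sup>n\<close> the second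
  term is integrable because \<open>q > 1\<close>; the first gives the convolution of an integrable function
  with a kernel whose integral over a ball of radius \<open>R\<close> is \<open>O(R)\<close> uniformly in the centre (each
  line through the origin meets the ball in a segment of length at most \<open>2R\<close>), hence is locally
  integrable. For \<open>p = 1\<close> the bound \<open>|f| / |y| \<le> |f| / \<epsilon>\<close> replaces Young's, and bounded functions
  of compact support belong to \<open>L\<^sup>1\<close>.\<close>

section \<open>Completed measures and affine changes of variable\<close>

lemma completion_ex_borel_measurable_complex:
  fixes g :: "'a \<Rightarrow> complex"
  assumes g: "g \<in> borel_measurable (completion M)"
  shows "\<exists>g'\<in>borel_measurable M. AE x in M. g x = g' x"
proof -
  obtain u v where u: "u \<in> borel_measurable M" "AE x in M. Re (g x) = u x"
    and v: "v \<in> borel_measurable M" "AE x in M. Im (g x) = v x"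
    using completion_ex_borel_measurable_real[of "\<lambda>x. Re (g x)" M]
      completion_ex_borel_measurable_real[of "\<lambda>x. Im (g x)" M] g
    by (auto simp: borel_measurable_complex_iff)
  show ?thesis
  proof
    show "(\<lambda>x. Complex (u x) (v x)) \<in> borel_measurable M"
      using u v by (simp add: borel_measurable_complex_iff)
    show "AE x in M. g x = Complex (u x) (v x)"
      using u(2) v(2) by eventually_elim (simp add: complex_eq_iff)
  qed
qed

text \<open>Carries an integral computed for a Borel representative \<open>g\<close> back to the
  Lebesgue measurable function \<open>f\<close>. Each preimage under \<open>f\<close> differs from
  the one under \<open>g\<close> by a null set, so completeness makes it measurable.\<close>

lemma has_bochner_integral_completion_AE:
  fixes g :: "'a \<Rightarrow> 'b::{banach, second_countable_topology}"
  assumes g: "has_bochner_integral M g I" and ae: "AE x in M. f x = g x"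
  shows "has_bochner_integral (completion M) f I"
proof -
  have gm: "g \<in> borel_measurable M" using g by auto
  have "f \<in> borel_measurable (completion M)"
  proof (rule measurableI)
    fix A :: "'b set" assume A: "A \<in> sets borel"
    have gA: "g -` A \<inter> space M \<in> sets M" using gm A by (rule measurable_sets)
    have eq: "AE x in completion M. x \<in> g -` A \<inter> space M \<longleftrightarrow> x \<in> f -` A \<inter> space (completion M)"
      by (rule AE_completion) (use ae in \<open>eventually_elim, auto\<close>)
    show "f -` A \<inter> space (completion M) \<in> sets (completion M)"
      by (rule completion.in_sets_AE[OF eq]) (use gA in auto)
  qed auto
  moreover have "has_bochner_integral (completion M) g I"
    using g gm unfolding has_bochner_integral_iff
    by (simp add: integrable_completion integral_completion)
  ultimately show ?thesis
    using AE_completion[OF ae] gm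
    by (subst has_bochner_integral_cong_AE[of _ _ g]) (auto intro: measurable_completion)
qed

text \<open>Lebesgue measure is a positive multiple of its image under an invertible affine map, so
  null sets pull back to null sets. Serves for the reflection \<open>c = -1\<close> and for
  dilations.\<close>

lemma AE_lborel_affine:
  fixes x :: "'a::euclidean_space"
  assumes ae: "AE y in lborel. P y" and c: "c \<noteq> 0"
  shows "AE y in lborel. P (x + c *\<^sub>R y)"
proof -
  have "AE y in density (distr lborel borel (\<lambda>y. x + c *\<^sub>R y)) (\<lambda>_. ennreal (\<bar>c\<bar>^DIM('a))). P y"
    using ae by (subst (asm) lborel_affine[OF c, of x])
  then have "AE y in distr lborel borel (\<lambda>y. x + c *\<^sub>R y). P y"
    using c by (subst (asm) AE_density) auto
  then show ?thesis by (rule AE_distrD[rotated]) simp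
qed

lemma nn_integral_lborel_affine:
  fixes g :: "'a::euclidean_space \<Rightarrow> ennreal"
  assumes [measurable]: "g \<in> borel_measurable borel" and c: "c \<noteq> 0"
  shows "(\<integral>\<^sup>+y. g y \<partial>lborel) = ennreal (\<bar>c\<bar>^DIM('a)) * (\<integral>\<^sup>+y. g (x + c *\<^sub>R y) \<partial>lborel)"
  by (subst lborel_affine[OF c, of x])
     (simp add: nn_integral_density nn_integral_distr nn_integral_cmult)

lemma has_bochner_integral_affine_reflect:
  fixes g :: "'a::euclidean_space \<Rightarrow> 'b::{banach, second_countable_topology}"
  assumes g: "has_bochner_integral lborel (\<lambda>y. g (x - y)) I"
    and [measurable]: "g \<in> borel_measurable borel"
  shows "has_bochner_integral lborel g I"
proof -
  have "lborel = distr lborel borel (\<lambda>y. x - y)"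
    using lborel_affine[of "-1" x] by (simp add: density_1)
  moreover have "has_bochner_integral (distr lborel borel (\<lambda>y. x - y)) g I"
    using g unfolding has_bochner_integral_iff by (simp add: integrable_distr_eq integral_distr)
  ultimately show ?thesis by simp
qed

section \<open>Radial integrals and polar coordinates\<close>

lemma nn_integral_inverse_power_atLeast:
  assumes "0 < a" "0 < n"
  shows "(\<integral>\<^sup>+t. ennreal (1 / t ^ Suc n) * indicator {a..} t \<partial>lborel) = ennreal (1 / (real n * a ^ n))"
proof -
  have "(\<integral>\<^sup>+t. ennreal (1 / t ^ Suc n) * indicator {a..} t \<partial>lborel) = ennreal (0 - (- (1 / (real n * a ^ n))))"
  proof (rule nn_integral_FTC_atLeast)
    show "DERIV (\<lambda>t. - (1 / (real n * t ^ n))) t :> 1 / t ^ Suc n" if "a \<le> t" for t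
    proof -
      obtain m where m: "n = Suc m" using assms by (cases n) auto
      have "t \<noteq> 0" using that assms by simp
      then have "DERIV (\<lambda>t. - (1 / real n) * inverse (t ^ n)) t :> 1 / t ^ Suc n"
        by (intro DERIV_cong[OF DERIV_cmult[OF DERIV_inverse_fun[OF DERIV_pow[of n t]]]])
           (auto simp: m field_simps simp del: of_nat_Suc)
      then show ?thesis by (simp add: divide_simps)
    qed
    show "((\<lambda>t. - (1 / (real n * t ^ n))) \<longlongrightarrow> 0) at_top"
    proof -
      have "LIM t at_top. real n * t ^ n :> at_top"
        using assms by (intro filterlim_tendsto_pos_mult_at_top[OF tendsto_const] filterlim_pow_at_top filterlim_ident) auto
      then have "((\<lambda>t. inverse (real n * t ^ n)) \<longlongrightarrow> 0) at_top"
        by (rule tendsto_inverse_0_at_top)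
      then show ?thesis by (auto dest: tendsto_minus simp: inverse_eq_divide)
    qed
  qed (use assms in auto)
  then show ?thesis by simp
qed

text \<open>Polar coordinates with directions averaged over the unit ball instead of the sphere: this
  needs only Tonelli and the scaling of Lebesgue measure, and matches the cone formula that
  defines the surface measure.\<close>

lemma nn_integral_cone_average:
  fixes g :: "'a::euclidean_space \<Rightarrow> ennreal"
  assumes [measurable]: "g \<in> borel_measurable borel"
  shows "(\<integral>\<^sup>+y. g y \<partial>lborel) = of_nat DIM('a) *
    (\<integral>\<^sup>+u. (\<integral>\<^sup>+s. ennreal (s ^ (DIM('a) - 1) * norm u ^ DIM('a)) * g (s *\<^sub>R u) * indicator {0<..} s \<partial>lborel)
         * indicator (cball 0 1) u \<partial>lborel)"
proof -
  define n where "n = DIM('a)"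
  have n: "0 < n" by (simp add: n_def)
  \<comment> \<open>The weight is chosen to be integrable in two orders. At
    \<open>v = s *\<^sub>R u\<close> the factor \<open>s ^ n\<close>, the Jacobian of
    \<open>u \<mapsto> s *\<^sub>R u\<close>, turns it into the integrand of the claim, with
    \<open>norm v \<le> s\<close> becoming \<open>norm u \<le> 1\<close>. For fixed nonzero
    \<open>v\<close>, its integral in \<open>s\<close> from \<open>norm v\<close> to infinity is
    \<open>g v / n\<close>, which cancels the dimension factor.\<close>
  define \<phi> where "\<phi> s v = ennreal (norm v ^ n / s ^ Suc n) * g v * indicator {norm v..} s * indicator {0<..} s"
    for s :: real and v :: 'a
  have [measurable]: "case_prod \<phi> \<in> borel_measurable (borel \<Otimes>\<^sub>M borel)"
    unfolding \<phi>_def by (simp add: case_prod_unfold indicator_def of_bool_def)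
  have "of_nat n * (\<integral>\<^sup>+u. (\<integral>\<^sup>+s. ennreal (s ^ (n - 1) * norm u ^ n) * g (s *\<^sub>R u) * indicator {0<..} s \<partial>lborel)
         * indicator (cball 0 1) u \<partial>lborel)
      = of_nat n * (\<integral>\<^sup>+u. (\<integral>\<^sup>+s. ennreal (s ^ n) * \<phi> s (s *\<^sub>R u) \<partial>lborel) \<partial>lborel)"
  proof -
    have "(\<integral>\<^sup>+s. ennreal (s ^ (n - 1) * norm u ^ n) * g (s *\<^sub>R u) * indicator {0<..} s \<partial>lborel) * indicator (cball 0 1) u
      = (\<integral>\<^sup>+s. ennreal (s ^ n) * \<phi> s (s *\<^sub>R u) \<partial>lborel)" for u :: 'a
    proof -
      have "(\<integral>\<^sup>+s. ennreal (s ^ (n - 1) * norm u ^ n) * g (s *\<^sub>R u) * indicator {0<..} s \<partial>lborel) * indicator (cball 0 1) u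
        = (\<integral>\<^sup>+s. ennreal (s ^ (n - 1) * norm u ^ n) * g (s *\<^sub>R u) * indicator {0<..} s * indicator (cball 0 1) u \<partial>lborel)"
        by (rule nn_integral_multc[symmetric]) measurable
      also have "\<dots> = (\<integral>\<^sup>+s. ennreal (s ^ n) * \<phi> s (s *\<^sub>R u) \<partial>lborel)"
      proof (rule nn_integral_cong)
        fix s :: real
        show "ennreal (s ^ (n - 1) * norm u ^ n) * g (s *\<^sub>R u) * indicator {0<..} s * indicator (cball 0 1) u
          = ennreal (s ^ n) * \<phi> s (s *\<^sub>R u)"
        proof (cases "0 < s")
          case True
          have "s ^ n * ((s * norm u) ^ n / s ^ Suc n) = s ^ (n - 1) * norm u ^ n"
            using True n by (cases n) (auto simp: field_simps power_mult_distrib)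
          then have "ennreal (s ^ (n - 1) * norm u ^ n) = ennreal (s ^ n) * ennreal ((s * norm u) ^ n / s ^ Suc n)"
            using True by (simp add: ennreal_mult[symmetric])
          then show ?thesis using True
            by (auto simp: \<phi>_def indicator_def mult.assoc)
        qed (auto simp: \<phi>_def)
      qed
      finally show ?thesis .
    qed
    then show ?thesis by simp
  qed
  also have "\<dots> = of_nat n * (\<integral>\<^sup>+s. (\<integral>\<^sup>+u. ennreal (s ^ n) * \<phi> s (s *\<^sub>R u) \<partial>lborel) \<partial>lborel)"
    by (subst lborel_pair.Fubini') simp_all
  also have "\<dots> = of_nat n * (\<integral>\<^sup>+s. (\<integral>\<^sup>+v. \<phi> s v \<partial>lborel) \<partial>lborel)"
  proof -
    have "(\<integral>\<^sup>+u. ennreal (s ^ n) * \<phi> s (s *\<^sub>R u) \<partial>lborel) = (\<integral>\<^sup>+v. \<phi> s v \<partial>lborel)" for s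
    proof (cases "0 < s")
      case True
      then show ?thesis
        by (subst nn_integral_lborel_affine[of "\<phi> s" s 0]) (simp_all add: nn_integral_cmult n_def)
    qed (simp add: \<phi>_def)
    then show ?thesis by simp
  qed
  also have "\<dots> = of_nat n * (\<integral>\<^sup>+v. (\<integral>\<^sup>+s. \<phi> s v \<partial>lborel) \<partial>lborel)"
    by (subst lborel_pair.Fubini') simp_all
  also have "\<dots> = (\<integral>\<^sup>+v. of_nat n * (\<integral>\<^sup>+s. \<phi> s v \<partial>lborel) \<partial>lborel)"
    by (rule nn_integral_cmult[symmetric]) measurable
  also have "\<dots> = (\<integral>\<^sup>+v. g v \<partial>lborel)"
  proof (rule nn_integral_cong_AE)
    have "AE v::'a in lborel. v \<noteq> 0" by (rule AE_lborel_singleton)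
    then show "AE v in lborel. of_nat n * (\<integral>\<^sup>+s. \<phi> s v \<partial>lborel) = g v"
    proof eventually_elim
      case (elim v)
      have "(\<integral>\<^sup>+s. \<phi> s v \<partial>lborel)
        = (\<integral>\<^sup>+s. (ennreal (norm v ^ n) * g v) * (ennreal (1 / s ^ Suc n) * indicator {norm v..} s) \<partial>lborel)"
      proof (rule nn_integral_cong)
        fix s :: real
        have "ennreal (norm v ^ n / s ^ Suc n) = ennreal (norm v ^ n) * ennreal (1 / s ^ Suc n)" if "0 < s"
          using that by (simp add: ennreal_mult[symmetric])
        then show "\<phi> s v = (ennreal (norm v ^ n) * g v) * (ennreal (1 / s ^ Suc n) * indicator {norm v..} s)"
          using elim zero_less_norm_iff[of v]
          by (cases "norm v \<le> s") (auto simp: \<phi>_def ac_simps simp del: zero_less_norm_iff)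
      qed
      also have "\<dots> = (ennreal (norm v ^ n) * g v) * ennreal (1 / (real n * norm v ^ n))"
        using elim n by (subst nn_integral_cmult) (simp_all del: power_Suc add: nn_integral_inverse_power_atLeast)
      finally have "of_nat n * (\<integral>\<^sup>+s. \<phi> s v \<partial>lborel)
        = g v * (ennreal (real n) * ennreal (norm v ^ n) * ennreal (1 / (real n * norm v ^ n)))"
        by (simp add: ac_simps ennreal_of_nat_eq_real_of_nat)
      also have "ennreal (real n) * ennreal (norm v ^ n) * ennreal (1 / (real n * norm v ^ n)) = 1"
        using elim n by (simp add: ennreal_mult[symmetric])
      finally show ?case by simp
    qed
  qed
  finally show ?thesis by (simp add: n_def)
qed

section \<open>Averages over dilates of the star-shaped set\<close>

text \<open>Homogeneity replaces \<open>W (y /\<^sub>R t)\<close> by \<open>W y\<close>, so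
  membership is a condition on \<open>t\<close> with threshold
  \<open>norm y / root n (norm (W y))\<close> when \<open>W y\<close> is nonzero. The origin, where
  homogeneity gives no information, lies in the removed ball because
  \<open>\<epsilon> > 0\<close>.\<close>

lemma mem_A_domain_iff:
  fixes W :: "'a::euclidean_space \<Rightarrow> complex"
  assumes W: "homogeneous_deg0 W" and "0 < \<epsilon>" "0 < t"
  shows "y \<in> A_domain W \<epsilon> t \<longleftrightarrow> \<epsilon> \<le> norm y \<and> norm y \<le> t * root DIM('a) (norm (W y))"
proof -
  have "y \<in> (\<lambda>x. t *\<^sub>R x) ` star_set W \<longleftrightarrow> y /\<^sub>R t \<in> star_set W"
    using \<open>0 < t\<close> by (auto intro: image_eqI[of _ _ "y /\<^sub>R t"])
  moreover have "norm (y /\<^sub>R t) \<le> r \<longleftrightarrow> norm y \<le> t * r" for r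
    using \<open>0 < t\<close> by (simp add: field_simps)
  moreover have "W (y /\<^sub>R t) = W y" if "y \<noteq> 0"
    using W that \<open>0 < t\<close> by (simp add: homogeneous_deg0_def)
  ultimately show ?thesis
    using \<open>0 < \<epsilon>\<close> by (cases "y = 0") (auto simp: A_domain_def star_set_def dist_norm not_less)
qed

lemma has_bochner_integral_inverse_power_atLeast:
  assumes "0 < a" "0 < n"
  shows "has_bochner_integral lborel (\<lambda>t::real. indicator {a..} t * (1 / t ^ Suc n)) (1 / (real n * a ^ n))"
proof (rule has_bochner_integral_nn_integral)
  have "ennreal (indicator {a..} t * (1 / t ^ Suc n)) = ennreal (1 / t ^ Suc n) * indicator {a..} t" for t :: real
    by (auto simp: indicator_def)
  then show "(\<integral>\<^sup>+t. ennreal (indicator {a..} t * (1 / t ^ Suc n)) \<partial>lborel) = ennreal (1 / (real n * a ^ n))"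
    by (simp only: nn_integral_inverse_power_atLeast[OF assms])
qed (use assms in \<open>auto simp: indicator_def\<close>)

text \<open>The exchange of integrals for fixed \<open>x\<close>, with \<open>h y\<close> standing
  for \<open>f (x - y) * k (x, x - y)\<close>. Then \<open>G\<close> is the truncated integrand of
  \<open>T_op\<close> after reflection, and its integrability is the single analytic input: it
  dominates each average and also gives integrability in \<open>(y, t)\<close> jointly.\<close>

lemma
  fixes W h :: "'a::euclidean_space \<Rightarrow> complex" and \<epsilon> :: real
  defines "G \<equiv> (\<lambda>y. indicator {y. \<epsilon> \<le> norm y} y *\<^sub>R (W y / of_real (norm y ^ DIM('a)) * h y))"
  assumes [measurable]: "W \<in> borel_measurable borel" "h \<in> borel_measurable borel"
    and hom: "homogeneous_deg0 W" and \<epsilon>: "0 < \<epsilon>"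
    and G: "integrable lborel G"
  shows integrable_star_average:
      "0 < t \<Longrightarrow> integrable lborel (\<lambda>y. indicator (A_domain W \<epsilon> t) y *\<^sub>R (h y * sgn (W y)))"
    and has_bochner_integral_star_averages:
      "has_bochner_integral lborel
        (\<lambda>t. indicator {0<..} t *\<^sub>R (of_real (1 / t ^ DIM('a)) *
           (LINT y|lborel. indicator (A_domain W \<epsilon> t) y *\<^sub>R (h y * sgn (W y))) / of_real t))
        ((LINT y|lborel. G y) / of_nat DIM('a))"
proof -
  define n where "n = DIM('a)"
  have n: "0 < n" by (simp add: n_def)
  define \<rho> where "\<rho> y = root n (norm (W y))" for y
  have \<rho>_pow: "\<rho> y ^ n = norm (W y)" and \<rho>_nonneg: "0 \<le> \<rho> y" for y
    using n by (simp_all add: \<rho>_def)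
  have [measurable]: "\<rho> \<in> borel_measurable borel" by (simp add: \<rho>_def[abs_def])
  have dom: "y \<in> A_domain W \<epsilon> t \<longleftrightarrow> \<epsilon> \<le> norm y \<and> norm y \<le> t * \<rho> y" if "0 < t" for t y
    using mem_A_domain_iff[OF hom \<epsilon> that] by (simp add: \<rho>_def n_def)
  have [measurable]: "G \<in> borel_measurable borel" using G by auto

  show star: "integrable lborel (\<lambda>y. indicator (A_domain W \<epsilon> t) y *\<^sub>R (h y * sgn (W y)))" if t: "0 < t" for t
  proof (rule Bochner_Integration.integrable_bound)
    \<comment> \<open>On the domain \<open>norm y ^ n \<le> t ^ n * norm (W y)\<close>, so
      multiplying \<open>h\<close> by \<open>t ^ n * norm (W y) / norm y ^ n\<close> can only
      enlarge its norm.\<close>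
    show "integrable lborel (\<lambda>y. (t ^ n) *\<^sub>R G y)" using G by simp
    have "A_domain W \<epsilon> t = {y \<in> space borel. \<epsilon> \<le> norm y \<and> norm y \<le> t * \<rho> y}"
      using dom[OF t] by auto
    also have "\<dots> \<in> sets borel" by measurable
    finally have [measurable]: "A_domain W \<epsilon> t \<in> sets borel" .
    show "(\<lambda>y. indicator (A_domain W \<epsilon> t) y *\<^sub>R (h y * sgn (W y))) \<in> borel_measurable lborel"
      unfolding sgn_div_norm by measurable
    have "norm (indicator (A_domain W \<epsilon> t) y *\<^sub>R (h y * sgn (W y))) \<le> norm ((t ^ n) *\<^sub>R G y)" for y
    proof (cases "y \<in> A_domain W \<epsilon> t")
      case True
      then have y: "\<epsilon> \<le> norm y" "norm y \<le> t * \<rho> y" using dom[OF t] by auto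
      have "0 < norm y" using y \<epsilon> by linarith
      have "norm y ^ n \<le> (t * \<rho> y) ^ n" using y by (intro power_mono) auto
      then have "1 \<le> t ^ n * norm (W y) / norm y ^ n"
        using \<open>0 < norm y\<close> by (simp add: power_mult_distrib \<rho>_pow le_divide_eq)
      then have "norm (h y) * 1 \<le> norm (h y) * (t ^ n * norm (W y) / norm y ^ n)"
        by (intro mult_left_mono) auto
      moreover have "norm (sgn (W y)) \<le> 1" by (simp add: norm_sgn)
      then have "norm (h y * sgn (W y)) \<le> norm (h y)"
        unfolding norm_mult by (intro mult_left_le) auto
      ultimately show ?thesis using y True t
        by (simp add: G_def n_def norm_mult norm_divide norm_power field_simps)
    qed (use t in \<open>simp add: zero_le_mult_iff\<close>)
    then show "AE y in lborel. norm (indicator (A_domain W \<epsilon> t) y *\<^sub>R (h y * sgn (W y))) \<le> norm ((t ^ n) *\<^sub>R G y)"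
      by simp
  qed

  \<comment> \<open>The joint integrand: the factor \<open>1 / t ^ n\<close> of the average and the
    \<open>1 / t\<close> of the measure \<open>dt / t\<close> merge into
    \<open>1 / t ^ Suc n\<close>. It vanishes for \<open>t \<le> 0\<close>, so integration may run
    over the whole line.\<close>
  define \<Phi> where "\<Phi> y t = (if 0 < t \<and> \<epsilon> \<le> norm y \<and> norm y \<le> t * \<rho> y
      then of_real (1 / t ^ Suc n) * (h y * sgn (W y)) else 0)" for y and t :: real
  have \<Phi>_meas: "case_prod \<Phi> \<in> borel_measurable (lborel \<Otimes>\<^sub>M lborel)"
    unfolding \<Phi>_def sgn_div_norm by measurable
  have \<Phi>: "has_bochner_integral lborel (\<Phi> y) (G y / of_nat n)
        \<and> has_bochner_integral lborel (\<lambda>t. norm (\<Phi> y t)) (norm (G y) / real n)" for y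
  proof (cases "\<epsilon> \<le> norm y \<and> W y \<noteq> 0")
    case True
    \<comment> \<open>\<open>a\<close> is the least dilation factor whose dilate of the star-shaped
      set contains \<open>y\<close>.\<close>
    define a where "a = norm y / \<rho> y"
    have "\<rho> y \<noteq> 0" using True \<rho>_pow[of y] n by (auto simp: zero_power)
    then have \<rho>: "0 < \<rho> y" using \<rho>_nonneg[of y] by simp
    have a: "0 < a" using True \<epsilon> \<rho> unfolding a_def by (intro divide_pos_pos) auto
    have y: "0 < norm y" using True \<epsilon> by linarith
    define c where "c = h y * sgn (W y)"
    note base = has_bochner_integral_inverse_power_atLeast[OF a n]
    have "0 < t \<and> \<epsilon> \<le> norm y \<and> norm y \<le> t * \<rho> y \<longleftrightarrow> a \<le> t" for t
      using True \<rho> less_le_trans[OF a, of t] by (auto simp: a_def divide_le_eq)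
    then have \<Phi>_eq: "\<Phi> y t = (indicator {a..} t * (1 / t ^ Suc n)) *\<^sub>R c" for t
      by (auto simp: \<Phi>_def c_def scaleR_conv_of_real indicator_def)
    have a_pow: "1 / (real n * a ^ n) = norm (W y) / norm y ^ n / real n"
      using \<rho> y by (simp add: a_def power_divide \<rho>_pow)
    \<comment> \<open>The \<open>t\<close>-integral produces only the modulus of \<open>W y\<close>;
      the sign carried by \<open>c\<close> restores \<open>W y\<close> itself.\<close>
    have c: "norm (W y) *\<^sub>R c = W y * h y"
      using True by (simp add: c_def sgn_div_norm scaleR_conv_of_real)
    have G_eq: "G y = W y / of_real (norm y ^ n) * h y" using True by (simp add: G_def n_def)
    have "(1 / (real n * a ^ n)) *\<^sub>R c = (1 / (norm y ^ n * real n)) *\<^sub>R (norm (W y) *\<^sub>R c)"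
      unfolding a_pow by simp
    also have "\<dots> = G y / of_nat n"
      unfolding c G_eq using y n by (simp add: scaleR_conv_of_real field_simps)
    finally have val: "(1 / (real n * a ^ n)) *\<^sub>R c = G y / of_nat n" .
    have 1: "has_bochner_integral lborel (\<Phi> y) (G y / of_nat n)"
      using has_bochner_integral_scaleR_left[OF base, of c] unfolding val \<Phi>_eq[abs_def] .
    have nval: "1 / (real n * a ^ n) * norm c = norm (G y) / real n"
      using arg_cong[OF val, of norm] a n by (simp add: norm_divide norm_mult)
    have "norm (\<Phi> y t) = indicator {a..} t * (1 / t ^ Suc n) * norm c" for t
      using a by (auto simp: \<Phi>_eq indicator_def norm_mult)
    then have "has_bochner_integral lborel (\<lambda>t. norm (\<Phi> y t)) (norm (G y) / real n)"
      using has_bochner_integral_mult_left[OF base, of "norm c"] by (simp only: nval)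
    with 1 show ?thesis by simp
  next
    case False
    have "\<Phi> y = (\<lambda>t. 0)"
    proof (rule ext)
      fix t
      show "\<Phi> y t = 0"
      proof (cases "\<epsilon> \<le> norm y")
        \<comment> \<open>Where \<open>W\<close> vanishes both sides are zero, by the convention
          \<open>sgn 0 = 0\<close>.\<close>
        case True
        with False have "W y = 0" by simp
        then show ?thesis by (simp add: \<Phi>_def)
      qed (simp add: \<Phi>_def)
    qed
    moreover have "G y = 0" using False by (auto simp: G_def)
    ultimately show ?thesis by (simp add: has_bochner_integral_zero)
  qed
  have int: "integrable (lborel \<Otimes>\<^sub>M lborel) (case_prod \<Phi>)"
  proof (rule lborel_pair.Fubini_integrable[OF \<Phi>_meas])
    have "(LINT t|lborel. norm (\<Phi> y t)) = norm (G y) / real n" for y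
      using \<Phi>[of y] by (simp add: has_bochner_integral_iff)
    then show "integrable lborel (\<lambda>y. LINT t|lborel. norm (case_prod \<Phi> (y, t)))"
      using G by simp
    show "AE y in lborel. integrable lborel (\<lambda>t. case_prod \<Phi> (y, t))"
      using \<Phi> by (simp add: has_bochner_integral_iff)
  qed
  have inner: "(LINT y|lborel. \<Phi> y t) = indicator {0<..} t *\<^sub>R (of_real (1 / t ^ DIM('a)) *
           (LINT y|lborel. indicator (A_domain W \<epsilon> t) y *\<^sub>R (h y * sgn (W y))) / of_real t)" for t
  proof (cases "0 < t")
    case True
    have "\<Phi> y t = of_real (1 / t ^ Suc n) * (indicator (A_domain W \<epsilon> t) y *\<^sub>R (h y * sgn (W y)))" for y
      using True dom[OF True, of y] by (auto simp: \<Phi>_def indicator_def)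
    then have "(LINT y|lborel. \<Phi> y t) =
        of_real (1 / t ^ Suc n) * (LINT y|lborel. indicator (A_domain W \<epsilon> t) y *\<^sub>R (h y * sgn (W y)))"
      by (simp only: integral_mult_right_zero)
    then show ?thesis using True by (simp add: n_def mult.commute)
  qed (simp add: \<Phi>_def)
  have "integrable lborel (\<lambda>t. LINT y|lborel. \<Phi> y t)"
    using lborel_pair.integrable_snd[OF int] .
  moreover have "(LINT t|lborel. LINT y|lborel. \<Phi> y t) = (LINT y|lborel. LINT t|lborel. \<Phi> y t)"
    using lborel_pair.Fubini_integral[OF int] .
  moreover have "(LINT t|lborel. \<Phi> y t) = G y / of_nat n" for y
    using \<Phi>[of y] by (simp add: has_bochner_integral_iff)
  ultimately have "has_bochner_integral lborel (\<lambda>t. LINT y|lborel. \<Phi> y t) ((LINT y|lborel. G y) / of_nat n)"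
    by (simp add: has_bochner_integral_iff)
  then show "has_bochner_integral lborel
        (\<lambda>t. indicator {0<..} t *\<^sub>R (of_real (1 / t ^ DIM('a)) *
           (LINT y|lborel. indicator (A_domain W \<epsilon> t) y *\<^sub>R (h y * sgn (W y))) / of_real t))
        ((LINT y|lborel. G y) / of_nat DIM('a))"
    unfolding inner n_def .
qed

section \<open>Almost everywhere finiteness of the truncated convolution\<close>

text \<open>Along the ray through \<open>u\<close> the polar weight
  \<open>s ^ (n - 1) * norm u ^ n\<close> times the kernel \<open>|W(y)| |y|^(1-n)\<close> is
  \<open>norm (W u) * norm u\<close>, constant in \<open>s\<close>. What remains is the arc length
  integral of \<open>\<phi>\<close> over the ray, which \<open>K\<close> bounds uniformly in the
  direction.\<close>

lemma nn_integral_homogeneous_kernel_le: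
  fixes W :: "'a::euclidean_space \<Rightarrow> complex" and \<phi> :: "'a \<Rightarrow> ennreal"
  assumes [measurable]: "W \<in> borel_measurable borel" "\<phi> \<in> borel_measurable borel"
    and hom: "homogeneous_deg0 W"
    and K: "\<And>u. u \<noteq> 0 \<Longrightarrow> ennreal (norm u) * (\<integral>\<^sup>+s. \<phi> (s *\<^sub>R u) * indicator {0<..} s \<partial>lborel) \<le> K"
  shows "(\<integral>\<^sup>+y. ennreal (norm (W y) * norm y / norm y ^ DIM('a)) * \<phi> y \<partial>lborel)
    \<le> of_nat DIM('a) * (K * (\<integral>\<^sup>+u. ennreal (norm (W u)) * indicator (cball 0 1) u \<partial>lborel))"
proof -
  have [measurable]: "cball c R \<in> sets borel" for c :: 'a and R
    by (rule borel_closed) simp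
  define n where "n = DIM('a)"
  have n: "0 < n" by (simp add: n_def)
  have radial: "ennreal (s ^ (n - 1) * norm u ^ n) *
          (ennreal (norm (W (s *\<^sub>R u)) * norm (s *\<^sub>R u) / norm (s *\<^sub>R u) ^ n) * \<phi> (s *\<^sub>R u)) * indicator {0<..} s
      = ennreal (norm (W u)) * ennreal (norm u) * (\<phi> (s *\<^sub>R u) * indicator {0<..} s)"
    if u: "u \<noteq> 0" for u s
  proof (cases "0 < s")
    case True
    have "s ^ (n - 1) * norm u ^ n * (norm (W (s *\<^sub>R u)) * norm (s *\<^sub>R u) / norm (s *\<^sub>R u) ^ n) = norm (W u) * norm u"
      using True u n hom by (cases n) (auto simp: homogeneous_deg0_def power_mult_distrib field_simps)
    then have "ennreal (s ^ (n - 1) * norm u ^ n) * ennreal (norm (W (s *\<^sub>R u)) * norm (s *\<^sub>R u) / norm (s *\<^sub>R u) ^ n)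
        = ennreal (norm (W u)) * ennreal (norm u)"
      using True by (simp add: ennreal_mult[symmetric])
    then show ?thesis using True by (simp add: mult.assoc[symmetric])
  qed simp
  have "(\<integral>\<^sup>+y. ennreal (norm (W y) * norm y / norm y ^ n) * \<phi> y \<partial>lborel)
      = of_nat n * (\<integral>\<^sup>+u. (\<integral>\<^sup>+s. ennreal (s ^ (n - 1) * norm u ^ n) *
          (ennreal (norm (W (s *\<^sub>R u)) * norm (s *\<^sub>R u) / norm (s *\<^sub>R u) ^ n) * \<phi> (s *\<^sub>R u)) * indicator {0<..} s \<partial>lborel)
         * indicator (cball 0 1) u \<partial>lborel)"
    unfolding n_def by (rule nn_integral_cone_average) measurable
  also have "\<dots> \<le> of_nat n * (\<integral>\<^sup>+u. K * (ennreal (norm (W u)) * indicator (cball 0 1) u) \<partial>lborel)"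
  proof (intro mult_left_mono nn_integral_mono_AE)
    have "AE u::'a in lborel. u \<noteq> 0" by (rule AE_lborel_singleton)
    then show "AE u in lborel. (\<integral>\<^sup>+s. ennreal (s ^ (n - 1) * norm u ^ n) *
          (ennreal (norm (W (s *\<^sub>R u)) * norm (s *\<^sub>R u) / norm (s *\<^sub>R u) ^ n) * \<phi> (s *\<^sub>R u)) * indicator {0<..} s \<partial>lborel)
         * indicator (cball 0 1) u \<le> K * (ennreal (norm (W u)) * indicator (cball 0 1) u)"
    proof eventually_elim
      case (elim u)
      have "ennreal (norm (W u)) * ennreal (norm u) * (\<integral>\<^sup>+s. \<phi> (s *\<^sub>R u) * indicator {0<..} s \<partial>lborel)
          \<le> ennreal (norm (W u)) * K"
        unfolding mult.assoc by (intro mult_left_mono K elim) simp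
      then show ?case
        unfolding radial[OF elim]
        by (subst nn_integral_cmult) (auto simp: indicator_def mult.commute)
    qed
  qed simp
  also have "\<dots> = of_nat n * (K * (\<integral>\<^sup>+u. ennreal (norm (W u)) * indicator (cball 0 1) u \<partial>lborel))"
    by (subst nn_integral_cmult) simp_all
  finally show ?thesis by (simp add: n_def)
qed

text \<open>Two points of the line inside the ball are at most \<open>2 * R\<close> apart. Centring
  an interval at an arbitrary one of them costs a factor 2 against the chord length, hence the
  constant 4.\<close>

lemma emeasure_line_cball_le:
  fixes u c :: "'a::euclidean_space"
  assumes u: "u \<noteq> 0" and R: "0 \<le> R"
  shows "emeasure lborel {s. s *\<^sub>R u \<in> cball c R} \<le> ennreal (4 * R / norm u)"
proof (cases "{s. s *\<^sub>R u \<in> cball c R} = {}")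
  case False
  then obtain r where r: "r *\<^sub>R u \<in> cball c R" by auto
  have "{s. s *\<^sub>R u \<in> cball c R} \<subseteq> {r - 2 * R / norm u .. r + 2 * R / norm u}"
  proof
    fix s assume "s \<in> {s. s *\<^sub>R u \<in> cball c R}"
    then have "dist (s *\<^sub>R u) (r *\<^sub>R u) \<le> 2 * R"
      using r dist_triangle[of "s *\<^sub>R u" "r *\<^sub>R u" c] by (simp add: dist_commute)
    then have "\<bar>s - r\<bar> * norm u \<le> 2 * R"
      by (simp add: dist_norm scaleR_left_diff_distrib[symmetric])
    then have "\<bar>s - r\<bar> \<le> 2 * R / norm u" using u by (simp add: field_simps)
    then show "s \<in> {r - 2 * R / norm u .. r + 2 * R / norm u}" by (simp add: abs_le_iff)
  qed
  then have "emeasure lborel {s. s *\<^sub>R u \<in> cball c R} \<le> emeasure lborel {r - 2 * R / norm u .. r + 2 * R / norm u}"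
    by (intro emeasure_mono) auto
  also have "\<dots> = ennreal (4 * R / norm u)" using u R by simp
  finally show ?thesis .
qed simp

text \<open>The kernel is controlled only on balls, uniformly in the centre. Integrating the
  convolution over \<open>x\<close> in a ball of radius \<open>R\<close> and applying Tonelli bounds
  the result by \<open>B R\<close> times the integral of \<open>g\<close>; so the convolution is
  finite almost everywhere in that ball, and countably many balls cover the space.\<close>

lemma AE_finite_convolution:
  fixes \<kappa> g :: "'a::euclidean_space \<Rightarrow> ennreal"
  assumes [measurable]: "\<kappa> \<in> borel_measurable borel" "g \<in> borel_measurable borel"
    and \<kappa>: "\<And>c R. 0 \<le> R \<Longrightarrow> (\<integral>\<^sup>+y. \<kappa> y * indicator (cball c R) y \<partial>lborel) \<le> B R"
    and B: "\<And>R. B R < \<infinity>"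
    and g: "(\<integral>\<^sup>+z. g z \<partial>lborel) < \<infinity>"
  shows "AE x in lborel. (\<integral>\<^sup>+y. \<kappa> y * g (x - y) \<partial>lborel) < \<infinity>"
proof -
  have [measurable]: "cball c R \<in> sets borel" for c :: 'a and R
    by (rule borel_closed) simp
  have "AE x in lborel. x \<in> cball 0 (real N) \<longrightarrow> (\<integral>\<^sup>+y. \<kappa> y * g (x - y) \<partial>lborel) < \<infinity>" for N
  proof -
    define R where "R = real N"
    let ?J = "\<lambda>x. (\<integral>\<^sup>+y. \<kappa> y * g (x - y) \<partial>lborel) * indicator (cball 0 R) x"
    have "(\<integral>\<^sup>+x. ?J x \<partial>lborel) = (\<integral>\<^sup>+x. (\<integral>\<^sup>+y. \<kappa> y * g (x - y) * indicator (cball 0 R) x \<partial>lborel) \<partial>lborel)"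
      by (simp add: nn_integral_multc)
    also have "\<dots> = (\<integral>\<^sup>+y. (\<integral>\<^sup>+x. \<kappa> y * g (x - y) * indicator (cball 0 R) x \<partial>lborel) \<partial>lborel)"
      by (rule lborel_pair.Fubini') (simp add: case_prod_unfold indicator_def of_bool_def dist_norm)
    also have "\<dots> = (\<integral>\<^sup>+y. (\<integral>\<^sup>+z. \<kappa> y * g z * indicator (cball (- z) R) y \<partial>lborel) \<partial>lborel)"
    \<comment> \<open>The substitution \<open>x = y + z\<close> turns \<open>norm x \<le> R\<close>
      into membership of \<open>y\<close> in the ball about \<open>- z\<close>.\<close>
    proof (rule nn_integral_cong)
      fix y :: 'a
      have "(\<integral>\<^sup>+x. \<kappa> y * g (x - y) * indicator (cball 0 R) x \<partial>lborel)
        = (\<integral>\<^sup>+z. \<kappa> y * g ((y + 1 *\<^sub>R z) - y) * indicator (cball 0 R) (y + 1 *\<^sub>R z) \<partial>lborel)"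
        by (subst nn_integral_lborel_affine[of _ 1 y]) simp_all
      also have "\<dots> = (\<integral>\<^sup>+z. \<kappa> y * g z * indicator (cball (- z) R) y \<partial>lborel)"
        by (intro nn_integral_cong) (auto simp: indicator_def dist_norm norm_minus_commute[of 0] algebra_simps
            norm_minus_commute[of "- z" y for z])
      finally show "(\<integral>\<^sup>+x. \<kappa> y * g (x - y) * indicator (cball 0 R) x \<partial>lborel)
        = (\<integral>\<^sup>+z. \<kappa> y * g z * indicator (cball (- z) R) y \<partial>lborel)" .
    qed
    also have "\<dots> = (\<integral>\<^sup>+z. (\<integral>\<^sup>+y. \<kappa> y * g z * indicator (cball (- z) R) y \<partial>lborel) \<partial>lborel)"
      by (rule lborel_pair.Fubini') (simp add: case_prod_unfold indicator_def of_bool_def dist_norm)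
    also have "\<dots> = (\<integral>\<^sup>+z. g z * (\<integral>\<^sup>+y. \<kappa> y * indicator (cball (- z) R) y \<partial>lborel) \<partial>lborel)"
      by (simp add: nn_integral_cmult[symmetric] ac_simps)
    also have "\<dots> \<le> (\<integral>\<^sup>+z. g z * B R \<partial>lborel)"
      by (intro nn_integral_mono mult_left_mono \<kappa>) (auto simp: R_def)
    also have "\<dots> = (\<integral>\<^sup>+z. g z \<partial>lborel) * B R" by (rule nn_integral_multc) simp
    also have "\<dots> < \<infinity>" using g B[of R] by (simp add: ennreal_mult_less_top)
    finally have "AE x in lborel. ?J x \<noteq> \<infinity>"
      by (intro nn_integral_PInf_AE) (simp_all add: less_top)
    then show ?thesis
      by eventually_elim (auto simp: R_def less_top)
  qed
  then have "AE x in lborel. \<forall>N. x \<in> cball 0 (real N) \<longrightarrow> (\<integral>\<^sup>+y. \<kappa> y * g (x - y) \<partial>lborel) < \<infinity>"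
    by (subst AE_all_countable) blast
  then show ?thesis
  proof eventually_elim
    case (elim x)
    obtain N where "norm x \<le> real N" using real_arch_simple by blast
    then show ?case using elim by auto
  qed
qed

lemma nn_integral_powr_atLeast_finite:
  assumes "1 < q" "0 < (\<epsilon>::real)"
  shows "(\<integral>\<^sup>+r. ennreal (r powr - q) * indicator {\<epsilon>..} r \<partial>lborel) < \<infinity>"
proof -
  have "(\<integral>\<^sup>+r. ennreal (r powr - q) * indicator {\<epsilon>..} r \<partial>lborel) = ennreal (0 - \<epsilon> powr (1 - q) / (1 - q))"
  proof (rule nn_integral_FTC_atLeast)
    show "DERIV (\<lambda>r. r powr (1 - q) / (1 - q)) r :> r powr - q" if "\<epsilon> \<le> r" for r
      using that assms
      by (intro DERIV_cong[OF DERIV_cdivide[OF has_real_derivative_powr]]) auto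
    have "((\<lambda>r::real. r powr (1 - q)) \<longlongrightarrow> 0) at_top"
      using assms by (intro tendsto_neg_powr filterlim_ident) auto
    then show "((\<lambda>r. r powr (1 - q) / (1 - q)) \<longlongrightarrow> 0) at_top"
      by (rule tendsto_divide_zero)
  qed simp_all
  then show ?thesis by simp
qed

text \<open>For \<open>p > 1\<close> the tail \<open>1 / r\<close> is not integrable on a ray; Young's inequality moves it to
  the conjugate power, which is.\<close>

lemma divide_le_powr_plus_integrable:
  assumes p: "1 \<le> p" and \<epsilon>: "0 < (\<epsilon>::real)"
  obtains C \<psi> where "0 \<le> C" "\<psi> \<in> borel_measurable borel" "\<And>r. 0 \<le> \<psi> r"
    "\<And>a r. 0 \<le> a \<Longrightarrow> \<epsilon> \<le> r \<Longrightarrow> a / r \<le> C * a powr p + \<psi> r"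
    "(\<integral>\<^sup>+r. ennreal (\<psi> r) * indicator {\<epsilon>..} r \<partial>lborel) < \<infinity>"
proof (cases "p = 1")
  case True
  have "a / r \<le> 1 / \<epsilon> * a powr p + 0" if "0 \<le> a" "\<epsilon> \<le> r" for a r
    using that \<epsilon> True by (simp add: frac_le)
  then show ?thesis using that[of "1 / \<epsilon>" "\<lambda>_. 0"] \<epsilon> by auto
next
  case False
  define q where "q = p / (p - 1)"
  have q: "1 < q" "1 / p + 1 / q = 1" using p False by (auto simp: q_def field_simps)
  have "a / r \<le> 1 * a powr p + r powr - q" if ar: "0 \<le> a" "\<epsilon> \<le> r" for a r
  proof -
    have "a * inverse r \<le> a powr p / p + inverse r powr q / q"
      using p False q ar \<epsilon> by (intro Youngs_inequality) auto
    \<comment> \<open>The factors \<open>1 / p\<close> and \<open>1 / q\<close> are below 1 and are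
      dropped, which gives \<open>C = 1\<close>.\<close>
    also have "\<dots> \<le> a powr p + inverse r powr q"
      using p q by (intro add_mono) (simp_all add: divide_le_eq mult_le_cancel_left1)
    also have "inverse r powr q = r powr - q"
      using ar \<epsilon> by (simp add: powr_minus inverse_powr)
    finally show ?thesis by (simp add: divide_inverse)
  qed
  then show ?thesis
    using that[of 1 "\<lambda>r. r powr - q"] nn_integral_powr_atLeast_finite[OF q(1) \<epsilon>] by auto
qed

text \<open>Moving one power of \<open>norm y\<close> from the kernel to \<open>f\<close> gives
  \<open>\<kappa> y\<close> times \<open>norm (f (x - y)) / norm y\<close>. The pointwise bound on
  this quotient leaves a tail \<open>\<kappa> y * \<phi> y\<close> independent of \<open>x\<close>
  and a convolution of \<open>\<kappa>\<close> with the integrable function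
  \<open>norm (f z) powr p\<close>.\<close>

lemma AE_finite_truncated_convolution:
  fixes W f :: "'a::euclidean_space \<Rightarrow> complex"
  assumes [measurable]: "W \<in> borel_measurable borel" "f \<in> borel_measurable borel"
    and hom: "homogeneous_deg0 W" and \<epsilon>: "0 < \<epsilon>" and p: "1 \<le> p"
    and W: "(\<integral>\<^sup>+u. ennreal (norm (W u)) * indicator (cball 0 1) u \<partial>lborel) < \<infinity>"
    and f: "(\<integral>\<^sup>+z. ennreal (norm (f z) powr p) \<partial>lborel) < \<infinity>"
  shows "AE x in lborel. (\<integral>\<^sup>+y. ennreal (norm (W y) / norm y ^ DIM('a) * norm (f (x - y)))
      * indicator {y. \<epsilon> \<le> norm y} y \<partial>lborel) < \<infinity>"
proof -
  obtain C \<psi> where C: "0 \<le> C" and [measurable]: "\<psi> \<in> borel_measurable borel" and \<psi>0: "\<And>r. 0 \<le> \<psi> r"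
    and le: "\<And>a r. 0 \<le> a \<Longrightarrow> \<epsilon> \<le> r \<Longrightarrow> a / r \<le> C * a powr p + \<psi> r"
    and \<psi>: "(\<integral>\<^sup>+r. ennreal (\<psi> r) * indicator {\<epsilon>..} r \<partial>lborel) < \<infinity>"
    using divide_le_powr_plus_integrable[OF p \<epsilon>] by blast
  have [measurable]: "cball c R \<in> sets borel" for c :: 'a and R
    by (rule borel_closed) simp
  define \<kappa> where "\<kappa> y = ennreal (norm (W y) * norm y / norm y ^ DIM('a))" for y
  define \<phi> where "\<phi> y = ennreal (\<psi> (norm y)) * indicator {\<epsilon>..} (norm y)" for y :: 'a
  define I where "I = (\<integral>\<^sup>+u. ennreal (norm (W u)) * indicator (cball 0 1) u \<partial>lborel)"
  have [measurable]: "\<kappa> \<in> borel_measurable borel" "\<phi> \<in> borel_measurable borel"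
    by (simp_all add: \<kappa>_def[abs_def] \<phi>_def[abs_def])
  have tail: "(\<integral>\<^sup>+y. \<kappa> y * \<phi> y \<partial>lborel) < \<infinity>"
  proof -
    define K where "K = (\<integral>\<^sup>+r. ennreal (\<psi> r) * indicator {\<epsilon>..} r \<partial>lborel)"
    have "(\<integral>\<^sup>+y. \<kappa> y * \<phi> y \<partial>lborel) \<le> of_nat DIM('a) * (K * I)"
      unfolding \<kappa>_def I_def
    proof (rule nn_integral_homogeneous_kernel_le)
      fix u :: 'a assume u: "u \<noteq> 0"
      \<comment> \<open>The one-dimensional scaling \<open>r = norm u * s\<close> makes the bound
        independent of \<open>u\<close>.\<close>
      have "K = ennreal (\<bar>norm u\<bar> ^ DIM(real)) *
          (\<integral>\<^sup>+s. ennreal (\<psi> (0 + norm u *\<^sub>R s)) * indicator {\<epsilon>..} (0 + norm u *\<^sub>R s) \<partial>lborel)"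
        unfolding K_def using u by (intro nn_integral_lborel_affine) auto
      moreover have "(\<integral>\<^sup>+s. \<phi> (s *\<^sub>R u) * indicator {0<..} s \<partial>lborel)
          \<le> (\<integral>\<^sup>+s. ennreal (\<psi> (0 + norm u *\<^sub>R s)) * indicator {\<epsilon>..} (0 + norm u *\<^sub>R s) \<partial>lborel)"
        by (intro nn_integral_mono) (auto simp: \<phi>_def indicator_def mult.commute)
      ultimately show "ennreal (norm u) * (\<integral>\<^sup>+s. \<phi> (s *\<^sub>R u) * indicator {0<..} s \<partial>lborel) \<le> K"
        by (simp add: mult_left_mono)
    qed (use hom in auto)
    also have "\<dots> < \<infinity>"
      using W \<psi> by (simp add: K_def I_def ennreal_mult_less_top of_nat_less_top)
    finally show ?thesis .
  qed
  have "AE x in lborel. (\<integral>\<^sup>+y. \<kappa> y * ennreal (norm (f (x - y)) powr p) \<partial>lborel) < \<infinity>"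
  \<comment> \<open>The kernel bound applies with the indicator of the ball as
    \<open>\<phi>\<close>: the chord estimate makes its integral along every ray at most
    \<open>4 * R\<close>, whatever the centre.\<close>
  proof (rule AE_finite_convolution[where B = "\<lambda>R. of_nat DIM('a) * (ennreal (4 * R) * I)"])
    fix c :: 'a and R :: real assume R: "0 \<le> R"
    show "(\<integral>\<^sup>+y. \<kappa> y * indicator (cball c R) y \<partial>lborel) \<le> of_nat DIM('a) * (ennreal (4 * R) * I)"
      unfolding \<kappa>_def I_def
    proof (rule nn_integral_homogeneous_kernel_le)
      fix u :: 'a assume u: "u \<noteq> 0"
      have "(\<integral>\<^sup>+s. indicator (cball c R) (s *\<^sub>R u) * indicator {0<..} s \<partial>lborel)
          \<le> (\<integral>\<^sup>+s. indicator {s. s *\<^sub>R u \<in> cball c R} s \<partial>lborel)"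
        by (intro nn_integral_mono) (auto simp: indicator_def)
      also have "\<dots> = emeasure lborel {s. s *\<^sub>R u \<in> cball c R}"
        by (rule nn_integral_indicator) simp
      also have "\<dots> \<le> ennreal (4 * R / norm u)" by (rule emeasure_line_cball_le[OF u R])
      finally have "ennreal (norm u) * (\<integral>\<^sup>+s. indicator (cball c R) (s *\<^sub>R u) * indicator {0<..} s \<partial>lborel)
          \<le> ennreal (norm u) * ennreal (4 * R / norm u)"
        by (rule mult_left_mono) simp
      also have "\<dots> = ennreal (4 * R)" using u R by (simp add: ennreal_mult[symmetric])
      finally show "ennreal (norm u) * (\<integral>\<^sup>+s. indicator (cball c R) (s *\<^sub>R u) * indicator {0<..} s \<partial>lborel)
          \<le> ennreal (4 * R)" .
    qed (use hom in simp_all)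
  next
    show "of_nat DIM('a) * (ennreal (4 * R) * I) < \<infinity>" for R
      using W by (simp add: I_def ennreal_mult_less_top of_nat_less_top)
  qed (use f in auto)
  then show ?thesis
  proof eventually_elim
    case (elim x)
    have "ennreal (norm (W y) / norm y ^ DIM('a) * norm (f (x - y))) * indicator {y. \<epsilon> \<le> norm y} y
        \<le> ennreal C * (\<kappa> y * ennreal (norm (f (x - y)) powr p)) + \<kappa> y * \<phi> y" for y
    proof (cases "\<epsilon> \<le> norm y")
      case True
      then have y: "0 < norm y" using \<epsilon> by linarith
      let ?a = "norm (f (x - y))" and ?k = "norm (W y) * norm y / norm y ^ DIM('a)"
      have "norm (W y) / norm y ^ DIM('a) * ?a = ?k * (?a / norm y)"
        using y by simp
      also have "\<dots> \<le> ?k * (C * ?a powr p + \<psi> (norm y))"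
        using True by (intro mult_left_mono le) auto
      also have "\<dots> = C * (?k * ?a powr p) + ?k * \<psi> (norm y)" by (simp add: algebra_simps)
      finally have "ennreal (norm (W y) / norm y ^ DIM('a) * ?a) \<le> ennreal (C * (?k * ?a powr p) + ?k * \<psi> (norm y))"
        by (rule ennreal_leI)
      also have "\<dots> = ennreal C * (ennreal ?k * ennreal (?a powr p)) + ennreal ?k * ennreal (\<psi> (norm y))"
      proof -
        have "ennreal (C * (k * b) + k * d) = ennreal C * (ennreal k * ennreal b) + ennreal k * ennreal d"
          if "0 \<le> k" "0 \<le> b" "0 \<le> d" for k b d :: real
          using that C by (simp add: ennreal_plus ennreal_mult)
        from this[of ?k "?a powr p" "\<psi> (norm y)"] show ?thesis using \<psi>0 by fastforce
      qed
      finally show ?thesis using True by (simp add: \<kappa>_def \<phi>_def)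
    qed simp
    then have "(\<integral>\<^sup>+y. ennreal (norm (W y) / norm y ^ DIM('a) * norm (f (x - y))) * indicator {y. \<epsilon> \<le> norm y} y \<partial>lborel)
        \<le> (\<integral>\<^sup>+y. ennreal C * (\<kappa> y * ennreal (norm (f (x - y)) powr p)) + \<kappa> y * \<phi> y \<partial>lborel)"
      by (intro nn_integral_mono)
    also have "\<dots> = ennreal C * (\<integral>\<^sup>+y. \<kappa> y * ennreal (norm (f (x - y)) powr p) \<partial>lborel) + (\<integral>\<^sup>+y. \<kappa> y * \<phi> y \<partial>lborel)"
      by (subst nn_integral_add) (simp_all add: nn_integral_cmult)
    also have "\<dots> < \<infinity>" using elim tail by (simp add: ennreal_mult_less_top)
    finally show ?case .
  qed
qed

section \<open>Borel representatives of the data\<close>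

lemma AE_scale_measureD:
  assumes ae: "AE x in scale_measure r M. P x" and r: "r \<noteq> 0"
  shows "AE x in M. P x"
proof -
  have "null_sets (scale_measure r M) = null_sets M"
    using r by (auto simp: null_sets_def)
  then show ?thesis using ae by (simp add: eventually_ae_filter space_scale_measure)
qed

text \<open>A Borel representative on the sphere is extended radially to \<open>W\<close>. Through
  the cone formula, agreement almost everywhere on the sphere becomes agreement almost everywhere in
  the unit ball, and the integral of \<open>norm (W u)\<close> over the ball is the spherical one
  divided by the dimension. Homogeneity then spreads the agreement to the whole space.\<close>

lemma sphere_integrable_borel_representative:
  fixes \<Omega> :: "'a::euclidean_space \<Rightarrow> complex"
  assumes hom: "homogeneous_deg0 \<Omega>" and int: "integrable sphere_measure \<Omega>"
  obtains W where "W \<in> borel_measurable borel" "homogeneous_deg0 W" "AE y in lborel. \<Omega> y = W y"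
    "(\<integral>\<^sup>+u. ennreal (norm (W u)) * indicator (cball 0 1) u \<partial>lborel) < \<infinity>"
proof -
  let ?B = "cball 0 1 - {0} :: 'a set" and ?S = "sphere 0 1 :: 'a set"
  let ?N = "restrict_space lborel ?B"
  define D where "D = distr ?N (restrict_space borel ?S) (\<lambda>x. x /\<^sub>R norm x)"
  define M where "M = scale_measure (of_nat DIM('a)) D"
  have sm: "sphere_measure = completion M" by (simp add: sphere_measure_def M_def D_def)
  have \<pi>: "(\<lambda>x. x /\<^sub>R norm x) \<in> ?N \<rightarrow>\<^sub>M restrict_space borel ?S"
    by (intro measurable_restrict_space3) auto
  have "\<Omega> \<in> borel_measurable (completion M)" using int unfolding sm by auto
  then obtain g where g: "g \<in> borel_measurable M" "AE x in M. \<Omega> x = g x"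
    using completion_ex_borel_measurable_complex by blast
  have gS: "g \<in> borel_measurable (restrict_space borel ?S)"
    using g(1) by (simp add: M_def D_def)
  \<comment> \<open>Extension by zero off the sphere gives a Borel function on the whole space. At
    the origin the quotient \<open>y /\<^sub>R norm y\<close> is 0, off the sphere, so
    \<open>W\<close> takes the value 0 there.\<close>
  define g' where "g' x = indicator ?S x *\<^sub>R g x" for x
  have [measurable]: "g' \<in> borel_measurable borel"
    using gS unfolding g'_def by (subst (asm) borel_measurable_restrict_space_iff) auto
  define W where "W y = g' (y /\<^sub>R norm y)" for y
  have W_eq: "W y = g (y /\<^sub>R norm y)" if "y \<noteq> 0" for y
    using that by (simp add: W_def g'_def)
  have W_meas[measurable]: "W \<in> borel_measurable borel" by (simp add: W_def[abs_def])
  have "W y = g' (sgn y)" for y by (simp add: W_def sgn_div_norm)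
  then have W_hom: "homogeneous_deg0 W" by (simp add: homogeneous_deg0_def sgn_scaleR)
  have \<Omega>_proj: "\<Omega> (y /\<^sub>R norm y) = \<Omega> y" if "y \<noteq> 0" for y
    using hom that by (simp add: homogeneous_deg0_def)
  have "AE x in D. \<Omega> x = g x"
    using g(2) unfolding M_def by (rule AE_scale_measureD) simp
  then have "AE u in ?N. \<Omega> (u /\<^sub>R norm u) = g (u /\<^sub>R norm u)"
    unfolding D_def by (rule AE_distrD[OF \<pi>])
  then have "AE u in lborel. u \<in> ?B \<longrightarrow> \<Omega> (u /\<^sub>R norm u) = g (u /\<^sub>R norm u)"
    by (subst (asm) AE_restrict_space_iff) auto
  then have ball: "AE u in lborel. u \<in> ?B \<longrightarrow> \<Omega> u = W u"
    by eventually_elim (auto simp: \<Omega>_proj W_eq)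
  \<comment> \<open>Dilation by \<open>1 / real (Suc N)\<close> brings the ball of radius
    \<open>Suc N\<close> into the unit ball and changes neither function away from 0;
    \<open>Suc N\<close> avoids division by zero.\<close>
  have "AE y in lborel. norm y \<le> real (Suc N) \<longrightarrow> y \<noteq> 0 \<longrightarrow> \<Omega> y = W y" for N
  proof -
    have "AE y in lborel. (0 + (1 / real (Suc N)) *\<^sub>R y) \<in> ?B \<longrightarrow>
        \<Omega> (0 + (1 / real (Suc N)) *\<^sub>R y) = W (0 + (1 / real (Suc N)) *\<^sub>R y)"
      by (rule AE_lborel_affine[OF ball]) simp
    then show ?thesis
    proof eventually_elim
      case (elim y)
      have "\<Omega> ((1 / real (Suc N)) *\<^sub>R y) = \<Omega> y" "W ((1 / real (Suc N)) *\<^sub>R y) = W y" if "y \<noteq> 0"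
        using hom W_hom that unfolding homogeneous_deg0_def by simp_all
      with elim show ?case by (auto simp: divide_le_eq simp del: of_nat_Suc)
    qed
  qed
  then have "AE y in lborel. \<forall>N. norm y \<le> real (Suc N) \<longrightarrow> y \<noteq> 0 \<longrightarrow> \<Omega> y = W y"
    by (subst AE_all_countable) blast
  moreover have "AE y::'a in lborel. y \<noteq> 0" by (rule AE_lborel_singleton)
  ultimately have ae: "AE y in lborel. \<Omega> y = W y"
  proof eventually_elim
    case (elim y)
    obtain N where "norm y \<le> real N" using real_arch_simple by blast
    then have "norm y \<le> real (Suc N)" by simp
    with elim show ?case by blast
  qed
  have "(\<integral>\<^sup>+x. ennreal (norm (g x)) \<partial>M) = (\<integral>\<^sup>+x. ennreal (norm (\<Omega> x)) \<partial>M)"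
    by (rule nn_integral_cong_AE) (use g(2) in \<open>eventually_elim, simp\<close>)
  also have "\<dots> = (\<integral>\<^sup>+x. ennreal (norm (\<Omega> x)) \<partial>completion M)"
    by (rule nn_integral_completion[symmetric])
  also have "\<dots> < \<infinity>" using int unfolding sm integrable_iff_bounded by simp
  finally have "of_nat DIM('a) * (\<integral>\<^sup>+x. ennreal (norm (g x)) \<partial>D) < \<infinity>"
    unfolding M_def using gS by (subst (asm) nn_integral_scale_measure) (auto simp: D_def)
  then have fin: "(\<integral>\<^sup>+x. ennreal (norm (g x)) \<partial>D) < \<infinity>"
    by (auto simp: ennreal_mult_less_top)
  have "(\<integral>\<^sup>+u. ennreal (norm (W u)) * indicator (cball 0 1) u \<partial>lborel)
      = (\<integral>\<^sup>+u. ennreal (norm (g (u /\<^sub>R norm u))) * indicator ?B u \<partial>lborel)"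
  proof (rule nn_integral_cong_AE)
    have "AE y::'a in lborel. y \<noteq> 0" by (rule AE_lborel_singleton)
    then show "AE u in lborel. ennreal (norm (W u)) * indicator (cball 0 1) u
        = ennreal (norm (g (u /\<^sub>R norm u))) * indicator ?B u"
      by eventually_elim (simp add: W_eq indicator_def)
  qed
  also have "\<dots> = (\<integral>\<^sup>+u. ennreal (norm (g (u /\<^sub>R norm u))) \<partial>?N)"
    by (rule nn_integral_restrict_space[symmetric]) simp
  also have "\<dots> = (\<integral>\<^sup>+x. ennreal (norm (g x)) \<partial>D)"
    unfolding D_def using gS by (intro nn_integral_distr[symmetric] \<pi>) simp
  finally show ?thesis using that[OF W_meas W_hom ae] fin by simp
qed

text \<open>Cutting the representative off at \<open>\<bar>C\<bar>\<close> changes it only on a null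
  set and makes the bound hold everywhere. It therefore passes to every slice
  \<open>k' (x, _)\<close>, although a slice may be a null set of the product space.\<close>

lemma Linfty_borel_representative:
  assumes "k \<in> Linfty (completion M)"
  obtains k' C where "k' \<in> borel_measurable M" "AE x in M. k x = k' x" "\<And>x. norm (k' x) \<le> C"
proof -
  obtain C where k: "k \<in> borel_measurable (completion M)" and "AE x in completion M. norm (k x) \<le> C"
    using assms by (auto simp: Linfty_def)
  then have C: "AE x in M. norm (k x) \<le> C" by (simp add: AE_completion_iff)
  obtain g where [measurable]: "g \<in> borel_measurable M" and g: "AE x in M. k x = g x"
    using completion_ex_borel_measurable_complex[OF k] by blast
  show ?thesis
  proof
    show "(\<lambda>x. if norm (g x) \<le> \<bar>C\<bar> then g x else 0) \<in> borel_measurable M" by measurable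
    show "AE x in M. k x = (if norm (g x) \<le> \<bar>C\<bar> then g x else 0)"
      using C g by eventually_elim auto
  qed auto
qed

lemma Lp_borel_representative:
  assumes "f \<in> Lp p (completion M)"
  obtains f' where "f' \<in> borel_measurable M" "AE x in M. f x = f' x"
    "(\<integral>\<^sup>+x. ennreal (norm (f' x) powr p) \<partial>M) < \<infinity>"
proof -
  have f: "f \<in> borel_measurable (completion M)" and int: "integrable (completion M) (\<lambda>x. norm (f x) powr p)"
    using assms by (auto simp: Lp_def)
  obtain f' where f'_meas: "f' \<in> borel_measurable M" and f': "AE x in M. f x = f' x"
    using completion_ex_borel_measurable_complex[OF f] by blast
  have "(\<integral>\<^sup>+x. ennreal (norm (f' x) powr p) \<partial>M) = (\<integral>\<^sup>+x. ennreal (norm (f x) powr p) \<partial>M)"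
    by (rule nn_integral_cong_AE) (use f' in \<open>eventually_elim, simp\<close>)
  also have "\<dots> = (\<integral>\<^sup>+x. ennreal (norm (f x) powr p) \<partial>completion M)"
    by (rule nn_integral_completion[symmetric])
  also have "\<dots> < \<infinity>" using int by (simp add: integrable_iff_bounded)
  finally show ?thesis using that[OF f'_meas f'] by simp
qed

lemma Linfty_compactly_supported_in_Lp_1:
  fixes f :: "'a::euclidean_space \<Rightarrow> complex"
  assumes f: "f \<in> Linfty lebesgue" and supp: "compactly_supported f"
  shows "f \<in> Lp 1 lebesgue"
proof -
  obtain C where f: "f \<in> borel_measurable lebesgue" and C: "AE x in lebesgue. norm (f x) \<le> C"
    using f by (auto simp: Linfty_def)
  obtain K where K: "compact K" "AE x in lebesgue. x \<notin> K \<longrightarrow> f x = 0"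
    using supp by (auto simp: compactly_supported_def)
  have "integrable lebesgue f"
  proof (rule Bochner_Integration.integrable_bound)
    have "integrable lborel (\<lambda>x. indicator K x *\<^sub>R C)"
      using borel_integrable_compact[of K "\<lambda>_. C"] K by simp
    then show "integrable lebesgue (\<lambda>x. indicator K x *\<^sub>R C)"
      by (subst integrable_completion) auto
    show "AE x in lebesgue. norm (f x) \<le> norm (indicator K x *\<^sub>R C)"
      using C K(2) by eventually_elim (auto simp: indicator_def)
  qed (rule f)
  then show ?thesis using f by (simp add: Lp_def)
qed

section \<open>The identity for almost every point\<close>

text \<open>Reconciles the strict truncation \<open>norm (x - y) > \<epsilon>\<close> in
  \<open>T_op\<close> with the closed condition \<open>\<epsilon> \<le> norm y\<close> left by
  removing an open ball in \<open>A_domain\<close>.\<close>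

lemma AE_lborel_norm_neq:
  fixes \<epsilon> :: real
  shows "AE y::'a::euclidean_space in lborel. norm y \<noteq> \<epsilon>"
proof -
  have "sphere (0::'a) \<epsilon> \<in> null_sets lebesgue"
    using negligible_sphere negligible_iff_null_sets by blast
  then have "AE y::'a in lebesgue. y \<notin> sphere 0 \<epsilon>" by (rule AE_not_in)
  then show ?thesis by (simp add: AE_completion_iff)
qed

theorem theoremA1:
  fixes \<Omega> :: "real ^ 'n \<Rightarrow> complex"
    and k :: "(real ^ 'n) \<times> (real ^ 'n) \<Rightarrow> complex"
    and f :: "real ^ 'n \<Rightarrow> complex"
    and \<epsilon> :: real
  assumes "CARD('n) \<ge> 2"
    and "homogeneous_deg0 \<Omega>"
    and "integrable sphere_measure \<Omega>"
    and "k \<in> Linfty lebesgue"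
    and "(f \<in> Linfty lebesgue \<and> compactly_supported f) \<or> (\<exists>p\<ge>1. f \<in> Lp p lebesgue)"
    and "\<epsilon> > 0"
  shows "AE x in lebesgue.
      T_integrand \<Omega> k f x absolutely_integrable_on {y. norm (x - y) > \<epsilon>}
    \<and> (\<forall>t>0. A_integrand \<Omega> k f x absolutely_integrable_on A_domain \<Omega> \<epsilon> t)
    \<and> (\<lambda>t. A_op \<Omega> k \<epsilon> t f x / of_real t) absolutely_integrable_on {0<..}
    \<and> T_op \<Omega> k \<epsilon> f x
        = of_nat CARD('n) * (LINT t:{0<..}|lebesgue. A_op \<Omega> k \<epsilon> t f x / of_real t)"
proof -
  let ?n = "DIM(real ^ 'n)"
  note \<epsilon> = \<open>\<epsilon> > 0\<close> and hom\<Omega> = \<open>homogeneous_deg0 \<Omega>\<close>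
  obtain W where W[measurable]: "W \<in> borel_measurable borel" and homW: "homogeneous_deg0 W"
    and \<Omega>W: "AE y in lborel. \<Omega> y = W y"
    and W_int: "(\<integral>\<^sup>+u. ennreal (norm (W u)) * indicator (cball 0 1) u \<partial>lborel) < \<infinity>"
    using sphere_integrable_borel_representative[OF assms(2,3)] by blast
  obtain k' C where "k' \<in> borel_measurable lborel" and kk': "AE z in lborel. k z = k' z"
    and C: "\<And>z. norm (k' z) \<le> C"
    using Linfty_borel_representative[OF assms(4)] by blast
  then have k'[measurable]: "k' \<in> borel_measurable (borel \<Otimes>\<^sub>M borel)" by (simp add: borel_prod)
  obtain p where p: "1 \<le> p" "f \<in> Lp p lebesgue"
    using assms(5) Linfty_compactly_supported_in_Lp_1 by blast
  obtain f' where "f' \<in> borel_measurable lborel" and ff': "AE y in lborel. f y = f' y"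
    and f'_int: "(\<integral>\<^sup>+y. ennreal (norm (f' y) powr p) \<partial>lborel) < \<infinity>"
    using Lp_borel_representative[OF p(2)] by blast
  then have f'[measurable]: "f' \<in> borel_measurable borel" by simp
  \<comment> \<open>A null set of the product has null slices over almost every
    \<open>x\<close>.\<close>
  have "AE z in (lborel::(real^'n) measure) \<Otimes>\<^sub>M lborel. k z = k' z"
    by (subst lborel_prod) (rule kk')
  then have ae_k: "AE x in lborel. AE y in lborel. k (x, y) = k' (x, y)"
    by (rule lborel_pair.AE_pair)
  have ae_fin: "AE x in lborel. (\<integral>\<^sup>+y. ennreal (norm (W y) / norm y ^ ?n * norm (f' (x - y)))
      * indicator {y. \<epsilon> \<le> norm y} y \<partial>lborel) < \<infinity>"
    by (rule AE_finite_truncated_convolution[OF W f' homW \<epsilon> p(1) W_int f'_int])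
  have dom_eq: "y \<in> A_domain \<Omega> \<epsilon> t \<longleftrightarrow> y \<in> A_domain W \<epsilon> t" if "\<Omega> y = W y" "0 < t" for y t
    using mem_A_domain_iff[OF hom\<Omega> \<epsilon>] mem_A_domain_iff[OF homW \<epsilon>] that by metis
  show ?thesis
  proof (rule AE_completion)
    show "AE x in lborel.
      T_integrand \<Omega> k f x absolutely_integrable_on {y. norm (x - y) > \<epsilon>}
    \<and> (\<forall>t>0. A_integrand \<Omega> k f x absolutely_integrable_on A_domain \<Omega> \<epsilon> t)
    \<and> (\<lambda>t. A_op \<Omega> k \<epsilon> t f x / of_real t) absolutely_integrable_on {0<..}
    \<and> T_op \<Omega> k \<epsilon> f x
        = of_nat CARD('n) * (LINT t:{0<..}|lebesgue. A_op \<Omega> k \<epsilon> t f x / of_real t)"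
      \<comment> \<open>The exceptional points \<open>x\<close> come from these two facts alone.
        Neither involves \<open>t\<close>, so one null set serves for all
        \<open>t > 0\<close>.\<close>
      using ae_k ae_fin
    proof eventually_elim
      case (elim x)
      define h where "h y = f' (x - y) * k' (x, x - y)" for y
      have h[measurable]: "h \<in> borel_measurable borel" unfolding h_def[abs_def] by measurable
      define G where "G = (\<lambda>y. indicator {y. \<epsilon> \<le> norm y} y *\<^sub>R (W y / of_real (norm y ^ ?n) * h y))"
      have [measurable]: "G \<in> borel_measurable borel" unfolding G_def by measurable
      have G: "integrable lborel G"
      proof (rule integrableI_bounded)
        have "(\<integral>\<^sup>+y. ennreal (norm (G y)) \<partial>lborel)
          \<le> (\<integral>\<^sup>+y. ennreal C * (ennreal (norm (W y) / norm y ^ ?n * norm (f' (x - y)))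
              * indicator {y. \<epsilon> \<le> norm y} y) \<partial>lborel)"
        proof (rule nn_integral_mono)
          fix y
          have "norm (W y) / norm y ^ ?n * norm (f' (x - y)) * norm (k' (x, x - y))
            \<le> norm (W y) / norm y ^ ?n * norm (f' (x - y)) * C"
            by (intro mult_left_mono C) auto
          then show "ennreal (norm (G y)) \<le> ennreal C * (ennreal (norm (W y) / norm y ^ ?n * norm (f' (x - y)))
              * indicator {y. \<epsilon> \<le> norm y} y)"
            \<comment> \<open>This supplies \<open>0 \<le> C\<close>, needed to factor
              \<open>ennreal C\<close> out of the product.\<close>
            using order_trans[OF norm_ge_zero C]
            by (auto simp: G_def h_def indicator_def norm_mult norm_divide norm_power
                ennreal_mult[symmetric] mult_ac intro!: ennreal_leI)
        qed
        also have "\<dots> = ennreal C * (\<integral>\<^sup>+y. ennreal (norm (W y) / norm y ^ ?n * norm (f' (x - y)))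
              * indicator {y. \<epsilon> \<le> norm y} y \<partial>lborel)"
          by (rule nn_integral_cmult) measurable
        also have "\<dots> < \<infinity>" using elim(2) by (simp add: ennreal_mult_less_top)
        finally show "(\<integral>\<^sup>+y. ennreal (norm (G y)) \<partial>lborel) < \<infinity>" .
      qed simp
      note star = integrable_star_average[OF W h homW \<epsilon> G[unfolded G_def]]
        and averages = has_bochner_integral_star_averages[OF W h homW \<epsilon> G[unfolded G_def]]

      have refl: "AE y in lborel. P (x - y)" if "AE y in lborel. P y" for P
        using AE_lborel_affine[OF that, of "-1" x] by simp
      \<comment> \<open>The reflection rule is used for the function
        \<open>\<lambda>y. G (x - y)\<close>, whose reflection is \<open>G\<close> again.\<close>
      have "has_bochner_integral lborel (\<lambda>y. G (x - y)) (LINT y|lborel. G y)"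
        by (rule has_bochner_integral_affine_reflect[of _ x]) (use G in \<open>simp_all add: has_bochner_integral_iff\<close>)
      moreover have "AE y in lborel. indicator {y. norm (x - y) > \<epsilon>} y *\<^sub>R T_integrand \<Omega> k f x y = G (x - y)"
        using ff' elim(1) refl[OF \<Omega>W] refl[OF AE_lborel_norm_neq[of \<epsilon>]]
        by eventually_elim (auto simp: T_integrand_def G_def h_def indicator_def)
      ultimately have T: "has_bochner_integral lebesgue
          (\<lambda>y. indicator {y. norm (x - y) > \<epsilon>} y *\<^sub>R T_integrand \<Omega> k f x y) (LINT y|lborel. G y)"
        by (rule has_bochner_integral_completion_AE)

      \<comment> \<open>In this variable \<open>f\<close> and \<open>k\<close> are taken at
        \<open>x - y\<close>, so their null sets are reflected while that of \<open>\<Omega>\<close>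
        is used as it is; in \<open>T_op\<close> it is the other way round.\<close>
      have A: "has_bochner_integral lebesgue (\<lambda>y. indicator (A_domain \<Omega> \<epsilon> t) y *\<^sub>R A_integrand \<Omega> k f x y)
          (LINT y|lborel. indicator (A_domain W \<epsilon> t) y *\<^sub>R (h y * sgn (W y)))" if t: "0 < t" for t
      proof (rule has_bochner_integral_completion_AE)
        show "has_bochner_integral lborel (\<lambda>y. indicator (A_domain W \<epsilon> t) y *\<^sub>R (h y * sgn (W y)))
            (LINT y|lborel. indicator (A_domain W \<epsilon> t) y *\<^sub>R (h y * sgn (W y)))"
          using star[OF t] by (simp add: has_bochner_integral_iff)
        show "AE y in lborel. indicator (A_domain \<Omega> \<epsilon> t) y *\<^sub>R A_integrand \<Omega> k f x y
            = indicator (A_domain W \<epsilon> t) y *\<^sub>R (h y * sgn (W y))"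
          using refl[OF ff'] refl[OF elim(1)] \<Omega>W
          by eventually_elim (simp add: A_integrand_def h_def indicator_def dom_eq[OF _ t])
      qed
      have "has_bochner_integral lebesgue (\<lambda>t. indicator {0<..} t *\<^sub>R (A_op \<Omega> k \<epsilon> t f x / of_real t))
          ((LINT y|lborel. G y) / of_nat ?n)"
        unfolding G_def
      proof (rule has_bochner_integral_completion_AE[OF averages])
        have A_op_eq: "A_op \<Omega> k \<epsilon> t f x = of_real (1 / t ^ ?n) *
            (LINT y|lborel. indicator (A_domain W \<epsilon> t) y *\<^sub>R (h y * sgn (W y)))" if "0 < t" for t
          using A[OF that] unfolding A_op_def set_lebesgue_integral_def has_bochner_integral_iff by simp
        \<comment> \<open>Replacing \<open>\<Omega>\<close>, \<open>k\<close> and \<open>f\<close>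
          by representatives alters the inner integrand only on a null set of \<open>y\<close>, so
          the averages agree at every \<open>t > 0\<close>.\<close>
        show "AE t in lborel. indicator {0<..} t *\<^sub>R (A_op \<Omega> k \<epsilon> t f x / of_real t)
          = indicator {0<..} t *\<^sub>R (of_real (1 / t ^ ?n) *
            (LINT y|lborel. indicator (A_domain W \<epsilon> t) y *\<^sub>R (h y * sgn (W y))) / of_real t)"
        proof (rule AE_I2)
          show "indicator {0<..} t *\<^sub>R (A_op \<Omega> k \<epsilon> t f x / of_real t)
            = indicator {0<..} t *\<^sub>R (of_real (1 / t ^ ?n) *
              (LINT y|lborel. indicator (A_domain W \<epsilon> t) y *\<^sub>R (h y * sgn (W y))) / of_real t)" for t
            by (cases "0 < t") (simp_all only: A_op_eq, simp)
        qed
      qed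
      \<comment> \<open>\<open>T_op\<close> equals the integral of \<open>G\<close>, and the
        \<open>t\<close>-integral equals that integral divided by the dimension, which is
        \<open>CARD('n)\<close>.\<close>
      with T A show ?case
        by (simp add: has_bochner_integral_iff set_integrable_def set_lebesgue_integral_def T_op_def)
    qed
  qed
qed

end
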